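(* Let $n,m\in\mathbb{N}$, $X:=\mathbb{R}^n$ with the Euclidean inner product and norm, and $I:=\{1,2,\ldots,m\}$. Let $(T_i)_{i\in I}$ be a family of continuous cutters $T_i:X\to X$, with fixed point sets $Q_i:=\{x\in X\mid T_i(x)=x\}$, and suppose that $Q:=\bigcap_{i\in I}Q_i\neq\emptyset$. Let $\tau_1,\tau_2>0$ with $\tau_1+\tau_2\leq 2$, let $x^0\in X$ be arbitrary, let $\sigma\in(0,\infty]$ satisfy $\sigma>d(x^0,Q)$, let $(\lambda_k)_{k=0}^\infty$ be a sequence of numbers in $[\tau_1,2-\tau_2]$, and let $(w_k)_{k=0}^\infty$ be a sequence of weight functions with respect to $I$. Let $(x^k)_{k=0}^\infty$ be any sequence generated by the generalized BIP algorithm with these data (defined in the context), that is, for every integer $k\ge 0$, $$x^{k+1}=x^k+\lambda_k\bigl(T_{w_k}(x^k)-x^k\bigr)+e^k,\qquad e^k=\sum_{i\in I}w_k(i)e^{k,i},$$ where the perturbations $e^{k,i}\in X$ are arbitrary vectors satisfying the admissibility bound stated in the context. Denote $\widehat{I}:=\{i\in I\mid \sum_{k=0}^\infty w_k(i)=\infty\}$ and $\widehat{Q}:=\bigcap_{i\in\widehat{I}}Q_i$, with the convention $\widehat{Q}:=X$ if $\widehat{I}=\emptyset$. Then $(x^k)_{k=0}^\infty$ converges to a point in $\widehat{Q}\cap B[x^0,2\sigma]$. In particular, if $\widehat{I}=I$, then $(x^k)_{k=0}^\infty$ converges to a point in $Q\cap B[x^0,2\sigma]$.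
   Context: $d(x,C):=\inf\{\|x-c\|\mid c\in C\}$. $B[x,r]$ is the closed ball with center $x$ and radius $r\in[0,\infty]$, with $B[x,\infty]=X$. An operator $T:X\to X$ is a separator of a nonempty set $S\subseteq X$ if $\langle x-T(x),q-T(x)\rangle\le 0$ for all $q\in S$ and $x\in X$. $T$ is a cutter if its fixed point set $\mathrm{Fix}(T)$ is nonempty and $T$ is a separator of $\mathrm{Fix}(T)$. A weight function with respect to $I$ is a function $w:I\to[0,1]$ with $\sum_{i\in I}w(i)=1$; for such $w$, $T_w(x):=\sum_{i\in I}w(i)T_i(x)$. Generalized BIP algorithm: starting from $x^0$, for each integer $k\geq 0$, $x^{k+1}:=x^k+\lambda_k(T_{w_k}(x^k)-x^k)+e^k$ with $e^k:=\sum_{i\in I}w_k(i)e^{k,i}$, where for each $i\in I$ the perturbation $e^{k,i}$ is any vector in $X$ satisfying the admissibility bound $$\|e^{k,i}\|\leq\frac12\cdot\frac{\lambda_k(2-\lambda_k)\|T_i(x^k)-x^k\|^2}{\sqrt{\zeta_{k,i}}+\lambda_k\|T_i(x^k)-x^k\|+2\sigma},$$ $$\zeta_{k,i}:=\bigl(\lambda_k\|T_i(x^k)-x^k\|+2\sigma\bigr)^2+\lambda_k(2-\lambda_k)\|T_i(x^k)-x^k\|^2.$$ If $\sigma=\infty$, the right-hand side of the bound is $0$, so all perturbations vanish. *)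

theory Defs
  imports "HOL-Analysis.Analysis"
begin

definition Fix :: "('a \<Rightarrow> 'a) \<Rightarrow> 'a set" where
  "Fix T = {x. T x = x}"

definition separator :: "('a::real_inner \<Rightarrow> 'a) \<Rightarrow> 'a set \<Rightarrow> bool" where
  "separator T S \<longleftrightarrow> S \<noteq> {} \<and> (\<forall>q\<in>S. \<forall>x. inner (x - T x) (q - T x) \<le> 0)"

definition cutter :: "('a::real_inner \<Rightarrow> 'a) \<Rightarrow> bool" where
  "cutter T \<longleftrightarrow> Fix T \<noteq> {} \<and> separator T (Fix T)"

(* For J = {} this is the whole space. *)
definition common_Fix :: "('i \<Rightarrow> 'a \<Rightarrow> 'a) \<Rightarrow> 'i set \<Rightarrow> 'a set" where
  "common_Fix T J = (\<Inter>i\<in>J. Fix (T i))"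

(* cball admits only real radii; here B[x,\<infinity>] is the whole space. *)
definition ext_cball :: "'a::metric_space \<Rightarrow> ereal \<Rightarrow> 'a set" where
  "ext_cball x r = {y. ereal (dist x y) \<le> r}"

definition weight_function :: "'i set \<Rightarrow> ('i \<Rightarrow> real) \<Rightarrow> bool" where
  "weight_function I w \<longleftrightarrow> (\<forall>i\<in>I. w i \<in> {0..1}) \<and> (\<Sum>i\<in>I. w i) = 1"

definition weighted_op ::
  "('i \<Rightarrow> 'a::real_vector \<Rightarrow> 'a) \<Rightarrow> 'i set \<Rightarrow> ('i \<Rightarrow> real) \<Rightarrow> 'a \<Rightarrow> 'a" where
  "weighted_op T I w x = (\<Sum>i\<in>I. w i *\<^sub>R T i x)"

definition bip_zeta ::
  "('a::real_normed_vector \<Rightarrow> 'a) \<Rightarrow> real \<Rightarrow> real \<Rightarrow> 'a \<Rightarrow> real" where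
  "bip_zeta T s l x =
     (l * norm (T x - x) + 2 * s)\<^sup>2 + l * (2 - l) * (norm (T x - x))\<^sup>2"

(* The case s = \<infinity> is split off because the quotient is formed in the reals,
   where real_of_ereal \<infinity> = 0. *)
definition bip_bound ::
  "('a::real_normed_vector \<Rightarrow> 'a) \<Rightarrow> ereal \<Rightarrow> real \<Rightarrow> 'a \<Rightarrow> real" where
  "bip_bound T s l x =
     (if s = \<infinity> then 0
      else 1 / 2 * (l * (2 - l) * (norm (T x - x))\<^sup>2 /
        (sqrt (bip_zeta T (real_of_ereal s) l x) + l * norm (T x - x) + 2 * real_of_ereal s)))"

definition generalized_BIP ::
  "('i \<Rightarrow> 'a::real_normed_vector \<Rightarrow> 'a) \<Rightarrow> 'i set \<Rightarrow> ereal \<Rightarrow> (nat \<Rightarrow> real) \<Rightarrow>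
   (nat \<Rightarrow> 'i \<Rightarrow> real) \<Rightarrow> 'a \<Rightarrow> (nat \<Rightarrow> 'i \<Rightarrow> 'a) \<Rightarrow> (nat \<Rightarrow> 'a) \<Rightarrow> bool" where
  "generalized_BIP T I s l w x0 e x \<longleftrightarrow>
     x 0 = x0 \<and>
     (\<forall>k. \<forall>i\<in>I. norm (e k i) \<le> bip_bound (T i) s (l k) (x k)) \<and>
     (\<forall>k. x (Suc k) = x k + l k *\<^sub>R (weighted_op T I (w k) (x k) - x k)
                        + (\<Sum>i\<in>I. w k i *\<^sub>R e k i))"

(* The series is summed in ereal, so that divergence of the nonnegative weights
   literally reads as having infinite sum. *)
definition divergent_indices :: "'i set \<Rightarrow> (nat \<Rightarrow> 'i \<Rightarrow> real) \<Rightarrow> 'i set" where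
  "divergent_indices I w = {i\<in>I. (\<Sum>k. ereal (w k i)) = \<infinity>}"

end

theory Submission
  imports Defs
begin

text \<open>
  The admissibility bound guarantees that a perturbed relaxed cutter step still decreases the
  squared distance to a common fixed point by at least half of the
  guaranteed unperturbed amount. Hence the iterates
  stay bounded and \<open>S k = \<Sum>i. w k i * norm (T i (x k) - x k)\<^sup>2\<close> is summable. Let \<open>p\<close> be a cluster
  point. Operators fixing \<open>p\<close> do not increase the distance to \<open>p\<close>, while the displacement of an
  operator that moves \<open>p\<close> is bounded away from zero near \<open>p\<close>, so it is at most a constant times its
  square. Near \<open>p\<close> a step therefore increases the distance to \<open>p\<close> by at most a constant times
  \<open>S k\<close>; an iterate that is close to \<open>p\<close> late enough never escapes, and the whole sequence converges
  to \<open>p\<close>. If \<open>T i\<close> moves \<open>p\<close>, summability of \<open>S\<close> forces \<open>\<Sum>k. w k i\<close> to be finite.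
\<close>

section \<open>Convergence and convexity tools\<close>

text \<open>The subsequence comes close to \<open>p\<close> so late that the remaining sum of
  \<open>S\<close> is small; this keeps all later iterates inside the ball where \<open>step\<close>
  applies.\<close>

lemma locally_quasi_Fejer_LIMSEQ:
  fixes x :: "nat \<Rightarrow> 'a::metric_space"
  assumes S: "summable S" and S0: "\<And>k. (0::real) \<le> S k" and r: "r > 0"
    and step: "\<And>k. dist (x k) p < r \<Longrightarrow> dist (x (Suc k)) p \<le> dist (x k) p + S k"
    and f: "strict_mono f" and lim: "(x \<circ> f) \<longlonglongrightarrow> p"
  shows "x \<longlonglongrightarrow> p"
proof (rule metric_LIMSEQ_I)
  fix \<epsilon> :: real assume "\<epsilon> > 0"
  define d where "d = min \<epsilon> r"
  have d: "d > 0" "d \<le> \<epsilon>" "d \<le> r" using \<open>\<epsilon> > 0\<close> r by (auto simp: d_def)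
  obtain N where N: "\<And>m n. m \<ge> N \<Longrightarrow> norm (sum S {m..<n}) < d / 2"
    using S d(1) unfolding summable_Cauchy by (meson half_gt_zero)
  obtain M where M: "\<And>j. j \<ge> M \<Longrightarrow> dist ((x \<circ> f) j) p < d / 2"
    using metric_LIMSEQ_D[OF lim, of "d / 2"] d(1) by auto
  \<comment> \<open>A strictly increasing \<open>f\<close> satisfies \<open>f n \<ge> n\<close>, so
    \<open>x K\<close> is near \<open>p\<close> and \<open>K\<close> is past
    \<open>N\<close>.\<close>
  define K where "K = f (max M N)"
  have KN: "K \<ge> N"
    using seq_suble[OF f, of "max M N"] by (simp add: K_def)
  have K: "dist (x K) p < d / 2" using M[of "max M N"] by (simp add: K_def)
  have tail: "sum S {K..<n} < d / 2" for n
    using N[OF KN, of n] by (simp add: abs_less_iff)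
  have "dist (x n) p \<le> dist (x K) p + sum S {K..<n}" if "n \<ge> K" for n
    using that
  proof (induction n rule: dec_induct)
    case base
    show ?case by simp
  next
    case (step n)
    have "dist (x n) p < r" using step.IH K tail[of n] d(3) by linarith
    from assms(4)[OF this] step show ?case by simp
  qed
  then have "dist (x n) p < \<epsilon>" if "n \<ge> K" for n
    using that K tail[of n] d(2) by fastforce
  then show "\<exists>K. \<forall>n\<ge>K. dist (x n) p < \<epsilon>" by blast
qed

lemma convex_combination_norm_square_le:
  fixes v :: "'i \<Rightarrow> 'a::real_normed_vector"
  assumes "finite I" "sum w I = 1" "\<And>i. i \<in> I \<Longrightarrow> w i \<ge> 0"
  shows "(norm (\<Sum>i\<in>I. w i *\<^sub>R v i))\<^sup>2 \<le> (\<Sum>i\<in>I. w i * (norm (v i))\<^sup>2)"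
proof -
  have "norm (\<Sum>i\<in>I. w i *\<^sub>R v i) \<le> (\<Sum>i\<in>I. w i * norm (v i))"
    by (rule sum_norm_le) (simp add: assms(3))
  then have "(norm (\<Sum>i\<in>I. w i *\<^sub>R v i))\<^sup>2 \<le> (\<Sum>i\<in>I. w i * norm (v i))\<^sup>2"
    by (simp add: power_mono)
  also have "\<dots> \<le> (\<Sum>i\<in>I. w i * (norm (v i))\<^sup>2)"
    using convex_on_sum[of I UNIV "\<lambda>t::real. t\<^sup>2" w "\<lambda>i. norm (v i)"] assms
    by (cases "I = {}") (auto simp: convex_power2)
  finally show ?thesis .
qed

section \<open>Relaxed steps of a single cutter\<close>

text \<open>With \<open>u = T x - x\<close> one has \<open>q - T x = (q - x) - u\<close>, and the
  separator inequality expands to the claim.\<close>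

lemma cutter_displacement_le:
  assumes T: "cutter T" and q: "q \<in> Fix T"
  shows "(norm (T x - x))\<^sup>2 \<le> inner (q - x) (T x - x)"
proof -
  have "inner (x - T x) (q - T x) \<le> 0"
    using T q unfolding cutter_def separator_def by blast
  then show ?thesis
    by (simp add: power2_norm_eq_inner inner_diff inner_commute algebra_simps)
qed

lemma relaxed_cutter_norm_square_le:
  assumes T: "cutter T" and q: "q \<in> Fix T" and l: "0 \<le> l"
  shows "(norm (x + l *\<^sub>R (T x - x) - q))\<^sup>2 \<le> (norm (x - q))\<^sup>2 - l * (2 - l) * (norm (T x - x))\<^sup>2"
proof -
  have "(norm (x + l *\<^sub>R (T x - x) - q))\<^sup>2
      = (norm (x - q))\<^sup>2 - 2 * l * inner (q - x) (T x - x) + l\<^sup>2 * (norm (T x - x))\<^sup>2"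
    unfolding power2_norm_eq_inner
    by (simp add: inner_diff inner_add inner_commute power2_eq_square algebra_simps)
  moreover have "l * (norm (T x - x))\<^sup>2 \<le> l * inner (q - x) (T x - x)"
    using cutter_displacement_le[OF T q] l by (rule mult_left_mono)
  ultimately show ?thesis by (simp add: power2_eq_square algebra_simps)
qed

lemma relaxed_cutter_norm_le:
  assumes "cutter T" and "q \<in> Fix T" and "0 \<le> l" "l \<le> 2"
  shows "norm (x + l *\<^sub>R (T x - x) - q) \<le> norm (x - q)"
proof (rule power2_le_imp_le)
  have "0 \<le> l * (2 - l) * (norm (T x - x))\<^sup>2" using assms(3,4) by simp
  then show "(norm (x + l *\<^sub>R (T x - x) - q))\<^sup>2 \<le> (norm (x - q))\<^sup>2"
    using relaxed_cutter_norm_square_le[OF assms(1-3), of x] by linarith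
qed simp

text \<open>
  Rationalising the quotient, \<open>bip_bound\<close> is half of \<open>sqrt (A\<^sup>2 + c) - A\<close>, where
  \<open>A = l * norm (T x - x) + 2 * s\<close> and \<open>c = l * (2 - l) * (norm (T x - x))\<^sup>2\<close>; so it is the
  nonnegative root \<open>r\<close> of \<open>4 * r\<^sup>2 + 4 * r * A = c\<close>.
\<close>
lemma bip_bound_admissible:
  assumes b: "b \<le> bip_bound T (ereal s) l x" "0 \<le> b" and s: "0 < s" and l: "0 \<le> l" "l \<le> 2"
  shows "b\<^sup>2 + 2 * s * b \<le> l * (2 - l) * (norm (T x - x))\<^sup>2 / 2"
proof -
  define A where "A = l * norm (T x - x) + 2 * s"
  define c where "c = l * (2 - l) * (norm (T x - x))\<^sup>2"
  define z where "z = sqrt (A\<^sup>2 + c)"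
  have A: "A \<ge> 2 * s" using l by (simp add: A_def)
  have c: "c \<ge> 0" using l by (simp add: c_def)
  have zA: "z \<ge> 0" "z\<^sup>2 = A\<^sup>2 + c" using c by (auto simp: z_def)
  have "bip_bound T (ereal s) l x = 1 / 2 * (c / (z + A))"
    by (simp add: bip_bound_def bip_zeta_def A_def c_def z_def algebra_simps)
  also have "\<dots> = (z - A) / 2"
  proof -
    have "c = (z - A) * (z + A)" using zA by (simp add: power2_eq_square algebra_simps)
    then show ?thesis using zA A s by simp
  qed
  finally have bz: "2 * b + A \<le> z" using b by simp
  then have "(2 * b + A)\<^sup>2 \<le> z\<^sup>2" using b(2) A s by (intro power_mono) auto
  then have "4 * b\<^sup>2 + 4 * (A * b) \<le> c" using zA by (simp add: power2_eq_square algebra_simps)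
  moreover have "2 * s * b \<le> A * b" using A b(2) by (rule mult_right_mono)
  ultimately show ?thesis using zero_le_power2[of b] c unfolding c_def[symmetric] by linarith
qed

section \<open>The perturbed iteration seen from a common fixed point\<close>

text \<open>\<open>s\<close> is a real stand-in for the possibly infinite radius;
  \<open>admissible\<close> is a quadratic form of the bound that covers both the finite and the
  infinite case.\<close>

locale perturbed_cutters =
  fixes T :: "'i \<Rightarrow> 'a::euclidean_space \<Rightarrow> 'a" and I :: "'i set"
    and \<tau>1 \<tau>2 s :: real and l :: "nat \<Rightarrow> real" and w :: "nat \<Rightarrow> 'i \<Rightarrow> real"
    and e :: "nat \<Rightarrow> 'i \<Rightarrow> 'a" and x :: "nat \<Rightarrow> 'a" and q :: 'a
  assumes fin: "finite I"
    and cont: "\<And>i. i \<in> I \<Longrightarrow> continuous_on UNIV (T i)"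
    and cutters: "\<And>i. i \<in> I \<Longrightarrow> cutter (T i)"
    and q: "q \<in> common_Fix T I" "norm (x 0 - q) \<le> s"
    and s: "s > 0" and \<tau>: "\<tau>1 > 0" "\<tau>2 > 0"
    and l: "\<And>k. l k \<in> {\<tau>1..2 - \<tau>2}"
    and weights: "\<And>k. weight_function I (w k)"
    and admissible: "\<And>k i. i \<in> I \<Longrightarrow>
      (norm (e k i))\<^sup>2 + 2 * s * norm (e k i) \<le> l k * (2 - l k) * (norm (T i (x k) - x k))\<^sup>2 / 2"
    and iter: "\<And>k. x (Suc k) = x k + l k *\<^sub>R (weighted_op T I (w k) (x k) - x k)
                        + (\<Sum>i\<in>I. w k i *\<^sub>R e k i)"
begin

definition S :: "nat \<Rightarrow> real" where
  "S k = (\<Sum>i\<in>I. w k i * (norm (T i (x k) - x k))\<^sup>2)"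

lemma w_nonneg: "i \<in> I \<Longrightarrow> w k i \<ge> 0"
  and sum_w: "(\<Sum>i\<in>I. w k i) = 1"
  using weights[of k] by (auto simp: weight_function_def)

lemma l_bounds: "0 \<le> l k" "l k \<le> 2"
  using l[of k] \<tau> by auto

lemma S_nonneg: "S k \<ge> 0"
  unfolding S_def by (intro sum_nonneg mult_nonneg_nonneg w_nonneg) auto

text \<open>As the weights sum to 1, an iterate is a convex combination of perturbed steps of single
  operators, so estimates can be proved one operator at a time.\<close>

lemma step_diff:
  "x (Suc k) - y = (\<Sum>i\<in>I. w k i *\<^sub>R (x k + l k *\<^sub>R (T i (x k) - x k) + e k i - y))"
proof -
  have "(\<Sum>i\<in>I. w k i *\<^sub>R (x k + l k *\<^sub>R (T i (x k) - x k) + e k i - y)) =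
    (\<Sum>i\<in>I. w k i *\<^sub>R (x k - l k *\<^sub>R x k - y) + l k *\<^sub>R (w k i *\<^sub>R T i (x k)) + w k i *\<^sub>R e k i)"
    by (rule sum.cong) (simp_all add: algebra_simps)
  also have "\<dots> = (\<Sum>i\<in>I. w k i) *\<^sub>R (x k - l k *\<^sub>R x k - y)
      + l k *\<^sub>R (\<Sum>i\<in>I. w k i *\<^sub>R T i (x k)) + (\<Sum>i\<in>I. w k i *\<^sub>R e k i)"
    by (simp only: sum.distrib scaleR_sum_left scaleR_sum_right)
  finally show ?thesis
    unfolding iter sum_w weighted_op_def by (simp add: algebra_simps)
qed

lemma norm_step_square_le:
  assumes xs: "norm (x k - q) \<le> s"
  shows "(norm (x (Suc k) - q))\<^sup>2 \<le> (norm (x k - q))\<^sup>2 - \<tau>1 * \<tau>2 / 2 * S k"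
proof -
  have "(norm (x k + l k *\<^sub>R (T i (x k) - x k) + e k i - q))\<^sup>2
      \<le> (norm (x k - q))\<^sup>2 - \<tau>1 * \<tau>2 / 2 * (norm (T i (x k) - x k))\<^sup>2" if i: "i \<in> I" for i
  proof -
    define y where "y = x k + l k *\<^sub>R (T i (x k) - x k) - q"
    have qi: "q \<in> Fix (T i)" using q(1) i by (auto simp: common_Fix_def)
    have y: "norm y \<le> s"
      using relaxed_cutter_norm_le[OF cutters[OF i] qi l_bounds] xs unfolding y_def
      by (rule order_trans)
    have "(norm (y + e k i))\<^sup>2 \<le> (norm y + norm (e k i))\<^sup>2"
      by (intro power_mono norm_triangle_ineq) simp
    also have "\<dots> = (norm y)\<^sup>2 + (norm (e k i))\<^sup>2 + 2 * (norm y * norm (e k i))"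
      by (simp add: power2_sum)
    \<comment> \<open>\<open>norm y \<le> s\<close> brings the cross term into the form that
      \<open>admissible\<close> bounds by half of the guaranteed decrease.\<close>
    also have "\<dots> \<le> (norm y)\<^sup>2 + ((norm (e k i))\<^sup>2 + 2 * s * norm (e k i))"
      using mult_right_mono[OF y, of "norm (e k i)"] by simp
    also have "\<dots> \<le> (norm (x k - q))\<^sup>2 - l k * (2 - l k) * (norm (T i (x k) - x k))\<^sup>2 / 2"
      using admissible[OF i, of k]
        relaxed_cutter_norm_square_le[OF cutters[OF i] qi l_bounds(1)[of k], of "x k"]
      unfolding y_def by linarith
    also have "\<dots> \<le> (norm (x k - q))\<^sup>2 - \<tau>1 * \<tau>2 / 2 * (norm (T i (x k) - x k))\<^sup>2"
    proof -
      have "\<tau>1 * \<tau>2 \<le> l k * (2 - l k)"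
        using l[of k] \<tau> by (intro mult_mono) auto
      from mult_right_mono[OF this, of "(norm (T i (x k) - x k))\<^sup>2"] show ?thesis by simp
    qed
    finally show ?thesis by (simp add: y_def algebra_simps)
  qed
  then have "(\<Sum>i\<in>I. w k i * (norm (x k + l k *\<^sub>R (T i (x k) - x k) + e k i - q))\<^sup>2) \<le>
    (\<Sum>i\<in>I. w k i * ((norm (x k - q))\<^sup>2 - \<tau>1 * \<tau>2 / 2 * (norm (T i (x k) - x k))\<^sup>2))"
    by (intro sum_mono mult_left_mono w_nonneg)
  also have "\<dots> = (\<Sum>i\<in>I. w k i) * (norm (x k - q))\<^sup>2 - \<tau>1 * \<tau>2 / 2 * S k"
    unfolding S_def sum_distrib_left sum_distrib_right sum_subtractf[symmetric]
    by (rule sum.cong) (simp_all add: algebra_simps)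
  finally show ?thesis
    using order_trans[OF convex_combination_norm_square_le[OF fin sum_w[of k] w_nonneg[of _ k]]]
    unfolding step_diff[of k q] sum_w by simp
qed

text \<open>The decrease estimate presupposes this bound and reproduces it.\<close>

lemma norm_iterate_le: "norm (x k - q) \<le> s"
proof (induction k)
  case 0
  show ?case by (rule q(2))
next
  case (Suc k)
  have "0 \<le> \<tau>1 * \<tau>2 / 2 * S k" using \<tau> S_nonneg by simp
  then have "(norm (x (Suc k) - q))\<^sup>2 \<le> (norm (x k - q))\<^sup>2"
    using norm_step_square_le[OF Suc] by linarith
  then have "norm (x (Suc k) - q) \<le> norm (x k - q)" by (rule power2_le_imp_le) simp
  with Suc show ?case by linarith
qed

lemma summable_S: "summable S"
proof -
  have "summable (\<lambda>k. \<tau>1 * \<tau>2 / 2 * S k)"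
  proof (rule bounded_imp_summable)
    show "0 \<le> \<tau>1 * \<tau>2 / 2 * S k" for k using \<tau> S_nonneg by simp
    \<comment> \<open>The decrease estimates telescope.\<close>
    have "(\<Sum>k<n. \<tau>1 * \<tau>2 / 2 * S k) \<le> (norm (x 0 - q))\<^sup>2 - (norm (x n - q))\<^sup>2" for n
    proof (induction n)
      case (Suc n)
      then show ?case using norm_step_square_le[OF norm_iterate_le, of n] by simp
    qed simp
    then show "(\<Sum>k\<le>n. \<tau>1 * \<tau>2 / 2 * S k) \<le> (norm (x 0 - q))\<^sup>2" for n
      unfolding lessThan_Suc_atMost[symmetric] by (rule order_trans) simp
  qed
  then show ?thesis using \<tau> by (simp add: summable_cmult_iff)
qed

section \<open>Local estimates and convergence\<close>

text \<open>Only finitely many operators move \<open>p\<close> and their displacements are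
  continuous, so one \<open>r\<close> and one \<open>\<delta>\<close> serve them all.\<close>

lemma displacement_bounded_away:
  obtains r \<delta> :: real where "r > 0" "\<delta> > 0"
    "\<And>i y. i \<in> I \<Longrightarrow> p \<notin> Fix (T i) \<Longrightarrow> dist y p < r \<Longrightarrow> \<delta> \<le> norm (T i y - y)"
proof -
  define J where "J = {i \<in> I. p \<notin> Fix (T i)}"
  \<comment> \<open>The element 1 keeps the set nonempty if no operator moves \<open>p\<close>;
    halving puts \<open>\<delta>\<close> strictly below each displacement at
    \<open>p\<close>.\<close>
  define \<delta> where "\<delta> = Min (insert 1 ((\<lambda>i. norm (T i p - p) / 2) ` J))"
  have J: "finite J" using fin by (simp add: J_def)
  have \<delta>: "\<delta> > 0" using J unfolding \<delta>_def by (auto simp: J_def Fix_def)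
  have "\<forall>\<^sub>F y in nhds p. \<delta> < norm (T i y - y)" if i: "i \<in> J" for i
  proof -
    have "isCont (T i) p"
      using cont i by (simp add: J_def continuous_on_eq_continuous_at)
    then have "isCont (\<lambda>y. norm (T i y - y)) p" by (intro continuous_intros)
    then have "((\<lambda>y. norm (T i y - y)) \<longlongrightarrow> norm (T i p - p)) (nhds p)"
      using isContD tendsto_at_iff_tendsto_nhds by blast
    moreover have "\<delta> < norm (T i p - p)"
    proof -
      have "\<delta> \<le> norm (T i p - p) / 2" using J i unfolding \<delta>_def by (intro Min_le) auto
      with \<delta> show ?thesis by simp
    qed
    ultimately show ?thesis by (rule order_tendstoD(1))
  qed
  then have "\<forall>\<^sub>F y in nhds p. \<forall>i\<in>J. \<delta> < norm (T i y - y)"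
    using J by (simp add: eventually_ball_finite)
  then obtain r where "r > 0" "\<forall>y. dist y p < r \<longrightarrow> (\<forall>i\<in>J. \<delta> < norm (T i y - y))"
    unfolding eventually_nhds_metric by blast
  with \<delta> show thesis by (intro that[of r \<delta>]) (auto simp: J_def intro: less_imp_le)
qed

text \<open>Being quadratic in the displacement, the perturbations can be charged to
  \<open>S\<close> whatever point distances are measured from.\<close>

lemma norm_perturbation_le:
  assumes i: "i \<in> I"
  shows "norm (e k i) \<le> 1 / (4 * s) * (norm (T i (x k) - x k))\<^sup>2"
proof -
  have "l k * (2 - l k) \<le> 1"
    using zero_le_power2[of "l k - 1"] by (simp add: power2_eq_square algebra_simps)
  from mult_right_mono[OF this zero_le_power2[of "norm (T i (x k) - x k)"]]
  have "2 * s * norm (e k i) \<le> (norm (T i (x k) - x k))\<^sup>2 / 2"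
    using admissible[OF i, of k] zero_le_power2[of "norm (e k i)"] by linarith
  then show ?thesis using s by (simp add: field_simps)
qed

lemma dist_step_le:
  assumes \<delta>: "\<delta> > 0" "\<And>i. i \<in> I \<Longrightarrow> p \<notin> Fix (T i) \<Longrightarrow> \<delta> \<le> norm (T i (x k) - x k)"
  shows "dist (x (Suc k)) p \<le> dist (x k) p + (2 / \<delta> + 1 / (4 * s)) * S k"
proof -
  have "norm (x k + l k *\<^sub>R (T i (x k) - x k) + e k i - p)
      \<le> norm (x k - p) + (2 / \<delta> + 1 / (4 * s)) * (norm (T i (x k) - x k))\<^sup>2"
    (is "?L \<le> _") if i: "i \<in> I" for i
  proof -
    let ?a = "norm (T i (x k) - x k)"
    have "norm (x k + l k *\<^sub>R (T i (x k) - x k) - p) \<le> norm (x k - p) + 2 / \<delta> * ?a\<^sup>2"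
    proof (cases "p \<in> Fix (T i)")
      case True
      have "0 \<le> 2 / \<delta> * ?a\<^sup>2" using \<delta>(1) by simp
      then show ?thesis
        using relaxed_cutter_norm_le[OF cutters[OF i] True l_bounds, of "x k" k] by linarith
    next
      case False
      \<comment> \<open>The step length is linear in \<open>?a\<close>; the lower bound
        \<open>\<delta> \<le> ?a\<close> trades it for a multiple of \<open>?a\<^sup>2\<close>, the
        quantity summed in \<open>S\<close>.\<close>
      have "l k * ?a \<le> 2 * ?a" using l_bounds by (intro mult_right_mono) auto
      also have "\<delta> * ?a \<le> ?a * ?a" using \<delta>(2)[OF i False] by (intro mult_right_mono) auto
      then have "2 * ?a \<le> 2 / \<delta> * ?a\<^sup>2" using \<delta>(1) by (simp add: field_simps power2_eq_square)
      finally have "norm (l k *\<^sub>R (T i (x k) - x k)) \<le> 2 / \<delta> * ?a\<^sup>2" using l_bounds by simp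
      then show ?thesis
        using norm_triangle_ineq[of "x k - p" "l k *\<^sub>R (T i (x k) - x k)"]
        by (simp add: algebra_simps)
    qed
    moreover have "?L \<le> norm (x k + l k *\<^sub>R (T i (x k) - x k) - p) + norm (e k i)"
      using norm_triangle_ineq[of "x k + l k *\<^sub>R (T i (x k) - x k) - p" "e k i"]
      by (simp add: algebra_simps)
    ultimately show ?thesis using norm_perturbation_le[OF i, of k] by (simp add: distrib_right)
  qed
  then have "norm (x (Suc k) - p)
      \<le> (\<Sum>i\<in>I. w k i * (norm (x k - p) + (2 / \<delta> + 1 / (4 * s)) * (norm (T i (x k) - x k))\<^sup>2))"
    unfolding step_diff by (intro sum_norm_le) (simp add: w_nonneg mult_left_mono)
  also have "\<dots> = (\<Sum>i\<in>I. w k i) * norm (x k - p) + (2 / \<delta> + 1 / (4 * s)) * S k"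
    unfolding S_def sum_distrib_left sum_distrib_right sum.distrib[symmetric]
    by (rule sum.cong) (simp_all add: algebra_simps)
  finally show ?thesis by (simp add: sum_w dist_norm)
qed

lemma convergent_iterates:
  obtains p where "x \<longlonglongrightarrow> p" "norm (p - q) \<le> s"
proof -
  have "bounded (range x)"
    using norm_iterate_le unfolding bounded_def
    by (metis (no_types, lifting) dist_commute dist_norm imageE)
  then obtain p f where f: "strict_mono f" "(x \<circ> f) \<longlonglongrightarrow> p"
    using bounded_imp_convergent_subsequence by blast
  obtain r \<delta> where r: "r > 0" "\<delta> > 0"
      "\<And>i y. i \<in> I \<Longrightarrow> p \<notin> Fix (T i) \<Longrightarrow> dist y p < r \<Longrightarrow> \<delta> \<le> norm (T i y - y)"
    using displacement_bounded_away[of p] by blast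
  have lim: "x \<longlonglongrightarrow> p"
  proof (rule locally_quasi_Fejer_LIMSEQ[OF _ _ r(1) _ f])
    show "summable (\<lambda>k. (2 / \<delta> + 1 / (4 * s)) * S k)"
      using summable_S by (rule summable_mult)
    show "0 \<le> (2 / \<delta> + 1 / (4 * s)) * S k" for k using r(2) s S_nonneg by simp
    show "dist (x (Suc k)) p \<le> dist (x k) p + (2 / \<delta> + 1 / (4 * s)) * S k"
      if "dist (x k) p < r" for k
      using dist_step_le r(2) r(3)[OF _ _ that] by blast
  qed
  have "norm (p - q) \<le> s"
    by (rule LIMSEQ_le_const2[OF tendsto_norm[OF tendsto_diff[OF lim tendsto_const]]])
       (use norm_iterate_le in blast)
  with lim that show thesis by blast
qed

lemma limit_in_Fix:
  assumes lim: "x \<longlonglongrightarrow> p" and i: "i \<in> divergent_indices I w"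
  shows "p \<in> Fix (T i)"
proof (rule ccontr)
  assume p: "p \<notin> Fix (T i)"
  have iI: "i \<in> I" and inf: "(\<Sum>k. ereal (w k i)) = \<infinity>" using i by (auto simp: divergent_indices_def)
  obtain r \<delta> where r: "r > 0" "\<delta> > 0"
      "\<And>i y. i \<in> I \<Longrightarrow> p \<notin> Fix (T i) \<Longrightarrow> dist y p < r \<Longrightarrow> \<delta> \<le> norm (T i y - y)"
    using displacement_bounded_away[of p] by blast
  obtain N where N: "\<And>k. k \<ge> N \<Longrightarrow> dist (x k) p < r"
    using metric_LIMSEQ_D[OF lim r(1)] by blast
  have "summable (\<lambda>k. w k i)"
  proof (rule summable_comparison_test')
    show "summable (\<lambda>k. 1 / \<delta>\<^sup>2 * S k)" using summable_S by (rule summable_mult)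
    fix k assume k: "k \<ge> N"
    \<comment> \<open>Past \<open>N\<close> the displacement of \<open>T i\<close> is at least
      \<open>\<delta>\<close>, so a single summand of \<open>S k\<close> already controls
      \<open>w k i\<close>.\<close>
    have "w k i * \<delta>\<^sup>2 \<le> w k i * (norm (T i (x k) - x k))\<^sup>2"
      using r(2) r(3)[OF iI p N[OF k]] by (intro mult_left_mono power_mono w_nonneg iI) auto
    also have "\<dots> \<le> S k"
      unfolding S_def using fin iI w_nonneg by (intro member_le_sum) auto
    finally show "norm (w k i) \<le> 1 / \<delta>\<^sup>2 * S k"
      using w_nonneg[OF iI] r(2) by (simp add: field_simps)
  qed
  then have "(\<Sum>k. ereal (w k i)) = ereal (\<Sum>k. w k i)"
    by (intro sums_unique[symmetric] iffD2[OF sums_ereal] summable_sums)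
  with inf show False by simp
qed

end

theorem theorem5p1:
  fixes m :: nat
    and T :: "nat \<Rightarrow> real ^ 'n \<Rightarrow> real ^ 'n"
    and \<tau>1 \<tau>2 :: real
    and x0 :: "real ^ 'n"
    and \<sigma> :: ereal
    and l :: "nat \<Rightarrow> real"
    and w :: "nat \<Rightarrow> nat \<Rightarrow> real"
    and e :: "nat \<Rightarrow> nat \<Rightarrow> real ^ 'n"
    and x :: "nat \<Rightarrow> real ^ 'n"
  assumes "\<And>i. i \<in> {1..m} \<Longrightarrow> continuous_on UNIV (T i)"
    and "\<And>i. i \<in> {1..m} \<Longrightarrow> cutter (T i)"
    and "common_Fix T {1..m} \<noteq> {}"
    and "\<tau>1 > 0" and "\<tau>2 > 0" and "\<tau>1 + \<tau>2 \<le> 2"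
    and "\<sigma> > 0" and "\<sigma> > ereal (infdist x0 (common_Fix T {1..m}))"
    and "\<And>k. l k \<in> {\<tau>1..2 - \<tau>2}"
    and "\<And>k. weight_function {1..m} (w k)"
    and "generalized_BIP T {1..m} \<sigma> l w x0 e x"
  shows "(\<exists>p \<in> common_Fix T (divergent_indices {1..m} w) \<inter> ext_cball x0 (2 * \<sigma>).
            x \<longlonglongrightarrow> p) \<and>
         (divergent_indices {1..m} w = {1..m} \<longrightarrow>
           (\<exists>p \<in> common_Fix T {1..m} \<inter> ext_cball x0 (2 * \<sigma>). x \<longlonglongrightarrow> p))"
proof -
  let ?Q = "common_Fix T {1..m}"
  have bip: "x 0 = x0" "\<And>k i. i \<in> {1..m} \<Longrightarrow> norm (e k i) \<le> bip_bound (T i) \<sigma> (l k) (x k)"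
    "\<And>k. x (Suc k) = x k + l k *\<^sub>R (weighted_op T {1..m} (w k) (x k) - x k)
                        + (\<Sum>i\<in>{1..m}. w k i *\<^sub>R e k i)"
    using assms(11) unfolding generalized_BIP_def by blast+
  have l2: "0 \<le> l k" "l k \<le> 2" for k using assms(4,5) assms(9)[of k] by auto
  \<comment> \<open>If \<sigma> is finite, \<open>s\<close> is its value, and the strict bound on
    the infimum yields \<open>q\<close> without its being attained. If \<sigma> is infinite, the
    perturbations vanish and any positive \<open>s\<close> that reaches \<open>q\<close> will
    do.\<close>
  obtain q s where q: "q \<in> ?Q" "norm (x0 - q) \<le> s" and s_pos: "s > 0" and s_le: "ereal s \<le> \<sigma>"
    and adm: "\<And>k i. i \<in> {1..m} \<Longrightarrow>
      (norm (e k i))\<^sup>2 + 2 * s * norm (e k i) \<le> l k * (2 - l k) * (norm (T i (x k) - x k))\<^sup>2 / 2"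
  proof (cases \<sigma>)
    case (real t)
    then have t: "t > 0" "infdist x0 ?Q < t" using assms(7,8) by simp_all
    then obtain q where "q \<in> ?Q" "dist x0 q < t"
      using assms(3) unfolding infdist_def by (auto simp: cInf_less_iff)
    with t(1) real bip(2) l2 show thesis
      by (intro that[of q t] bip_bound_admissible) (simp_all add: dist_norm)
  next
    case PInf
    obtain q where "q \<in> ?Q" using assms(3) by blast
    moreover have "e k i = 0" if "i \<in> {1..m}" for k i
      using bip(2)[OF that, of k] PInf by (simp add: bip_bound_def)
    \<comment> \<open>Adding 1 keeps \<open>s\<close> positive even when
      \<open>x0 = q\<close>.\<close>
    ultimately show thesis
      using PInf l2 by (intro that[of q "norm (x0 - q) + 1"]) (simp_all add: add_nonneg_pos)
  qed (use assms(7) in simp)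
  interpret perturbed_cutters T "{1..m}" \<tau>1 \<tau>2 s l w e x q
    using assms(1,2,4,5,9,10) bip(1,3) q s_pos adm by unfold_locales simp_all
  obtain p where p: "x \<longlonglongrightarrow> p" "norm (p - q) \<le> s" by (rule convergent_iterates)
  \<comment> \<open>Both \<open>x0\<close> and \<open>p\<close> lie within \<open>s\<close> of
    \<open>q\<close>, hence the factor 2.\<close>
  have "dist x0 p \<le> 2 * s"
    using p(2) q(2) dist_triangle2[of x0 p q] unfolding dist_norm bip(1) by linarith
  then have "ereal (dist x0 p) \<le> 2 * ereal s" by simp
  also have "\<dots> \<le> 2 * \<sigma>" using s_le by (intro ereal_mult_left_mono) auto
  finally have "p \<in> ext_cball x0 (2 * \<sigma>)" by (simp add: ext_cball_def)
  moreover have "p \<in> common_Fix T (divergent_indices {1..m} w)"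
    using limit_in_Fix[OF p(1)] by (simp add: common_Fix_def)
  ultimately show ?thesis using p(1) by auto
qed

end
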